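(* Let $\widehat{Z}=\{\mathbb{I};\,\sigma_n,\ n\in I_+\}$ and let $\widehat{Z}^*=\{\mathbb{I};\,\sigma_n,\ n\in I_-\}$ be its dual. 1. The IFS $\widehat{Z}$ has a point-fibred attractor $\mathbb{I}_+$ with basin $\mathbb{I}\setminus\mathbb{I}_-$ and fast basin $$\widehat{\mathbb{I}}:=\{\iota\in\mathbb{I}: \text{there exists } k\in\mathbb{N}\text{ such that }\iota_j\in I_-\text{ if } j<k \text{ and } \iota_j\in I_+ \text{ if } j\geq k\}.$$ 2. The dual IFS $\widehat{Z}^*$ has point-fibred attractor $\mathbb{I}_-$ with basin $\mathbb{I}\setminus\mathbb{I}_+$ and fast basin $$\widehat{\mathbb{I}}^*:=\{\iota\in\mathbb{I}: \text{there exists } k\in\mathbb{N}\text{ such that }\iota_j\in I_+\text{ if } j<k \text{ and } \iota_j\in I_- \text{ if } j\geq k\}.$$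
   Context: Fix $N\in\mathbb{N}=\{1,2,\dots\}$. $I_+=\{1,\dots,N\}$, $I_-=\{-1,\dots,-N\}$, $I=I_+\cup I_-$; $\mathbb{I}_+=I_+^\infty$, $\mathbb{I}_-=I_-^\infty$, $\mathbb{I}_0=I^\infty$ (infinite words indexed by $\mathbb{N}$), and $\mathbb{I}=\{\iota\in\mathbb{I}_0:\iota_i\neq-\iota_{i+1}\text{ for all } i\in\mathbb{N}\}$. The metric on these spaces is $d_{\mathbb{I}}(\iota,\omega)=\max\{2^{-k}:k\in\mathbb{N},\ \iota_k\neq\omega_k\}$ for $\iota\ne\omega$ and $0$ if $\iota=\omega$; $(\mathbb{I},d_{\mathbb{I}})$ is compact. For $n\in I$ the map $\sigma_n:\mathbb{I}\to\mathbb{I}$ is $\sigma_n(\iota_1\iota_2\cdots)=n\iota_1\iota_2\cdots$ if $\iota_1\neq-n$, and $\sigma_n(\iota_1\iota_2\cdots)=\iota_2\iota_3\cdots$ if $\iota_1=-n$; it is a homeomorphism with inverse $\sigma_{-n}$. An iterated function system (IFS) $\{\mathbb{X};\,g_n,\ n\in J\}$ is a complete metric space $\mathbb{X}$ with a finite family of homeomorphisms $g_n$ of $\mathbb{X}$ onto itself; its dual is $\{\mathbb{X};\,g_n^{-1},\ n\in J\}$. $H$ is the set of nonempty compact subsets of $\mathbb{X}$ with the Hausdorff metric. Put $F(S)=\bigcup_{n\in J} g_n(S)$ for $S\subset\mathbb{X}$, with $k$-fold iterates $F^k$. An attractor is a set $A\in H$ with $F(A)=A$ for which there is an open set $U\supset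 A$ such that $F^k(C)\to A$ in the Hausdorff metric for every $C\in H$ with $C\subset U$. The union of all such open $U$ is the basin $B(A)$ of $A$. $A$ is point-fibred if for every word $\iota\in J^\infty$ the limit $\lim_{k\to\infty}g_{\iota_1}\circ\cdots\circ g_{\iota_k}(C)$ exists in the Hausdorff metric for all $C\in H$ with $C\subset B(A)$, is a singleton subset of $A$, and is independent of $C$. The fast basin of $A$ is $\{x\in\mathbb{X}:F^K(\{x\})\cap A\neq\varnothing\text{ for some }K\in\mathbb{N}\}$. *)

theory Defs
  imports "HOL-Analysis.Analysis" "HOL-Library.Stream"
begin

section \<open>Iterated function systems\<close>

text \<open>The metric space is given by a carrier \<open>M\<close> and a distance \<open>d\<close>, and the maps by a family
  \<open>g\<close> indexed by \<open>J\<close>; only the behaviour of \<open>g n\<close>, \<open>n \<in> J\<close>, on \<open>M\<close> matters.\<close>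

definition is_ifs :: "'a set \<Rightarrow> ('a \<Rightarrow> 'a \<Rightarrow> real) \<Rightarrow> 'j set \<Rightarrow> ('j \<Rightarrow> 'a \<Rightarrow> 'a) \<Rightarrow> bool" where
  "is_ifs M d J g \<longleftrightarrow>
     Metric_space M d \<and> Metric_space.mcomplete M d \<and> finite J \<and>
     (\<forall>n\<in>J. homeomorphic_map (Metric_space.mtopology M d) (Metric_space.mtopology M d) (g n))"

definition dual_maps :: "'a set \<Rightarrow> ('j \<Rightarrow> 'a \<Rightarrow> 'a) \<Rightarrow> 'j \<Rightarrow> 'a \<Rightarrow> 'a" where
  "dual_maps M g n = inv_into M (g n)"

definition nonempty_compacts :: "'a set \<Rightarrow> ('a \<Rightarrow> 'a \<Rightarrow> real) \<Rightarrow> 'a set set" where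
  "nonempty_compacts M d = {C. compactin (Metric_space.mtopology M d) C \<and> C \<noteq> {}}"

definition hausdorff_dist :: "('a \<Rightarrow> 'a \<Rightarrow> real) \<Rightarrow> 'a set \<Rightarrow> 'a set \<Rightarrow> real" where
  "hausdorff_dist d A B = max (SUP a\<in>A. INF b\<in>B. d a b) (SUP b\<in>B. INF a\<in>A. d a b)"

text \<open>Convergence of a sequence in the metric space of nonempty compact sets.\<close>

definition hausdorff_lim ::
    "'a set \<Rightarrow> ('a \<Rightarrow> 'a \<Rightarrow> real) \<Rightarrow> (nat \<Rightarrow> 'a set) \<Rightarrow> 'a set \<Rightarrow> bool" where
  "hausdorff_lim M d S A \<longleftrightarrow>
     (\<forall>k. S k \<in> nonempty_compacts M d) \<and> A \<in> nonempty_compacts M d \<and>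
     (\<lambda>k. hausdorff_dist d (S k) A) \<longlonglongrightarrow> 0"

definition hutchinson :: "'j set \<Rightarrow> ('j \<Rightarrow> 'a \<Rightarrow> 'a) \<Rightarrow> 'a set \<Rightarrow> 'a set" where
  "hutchinson J g S = (\<Union>n\<in>J. g n ` S)"

definition attracting_nbhd ::
    "'a set \<Rightarrow> ('a \<Rightarrow> 'a \<Rightarrow> real) \<Rightarrow> 'j set \<Rightarrow> ('j \<Rightarrow> 'a \<Rightarrow> 'a) \<Rightarrow> 'a set \<Rightarrow> 'a set \<Rightarrow> bool" where
  "attracting_nbhd M d J g A U \<longleftrightarrow>
     openin (Metric_space.mtopology M d) U \<and> A \<subseteq> U \<and>
     (\<forall>C\<in>nonempty_compacts M d. C \<subseteq> U \<longrightarrow>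
        hausdorff_lim M d (\<lambda>k. (hutchinson J g ^^ k) C) A)"

definition is_attractor ::
    "'a set \<Rightarrow> ('a \<Rightarrow> 'a \<Rightarrow> real) \<Rightarrow> 'j set \<Rightarrow> ('j \<Rightarrow> 'a \<Rightarrow> 'a) \<Rightarrow> 'a set \<Rightarrow> bool" where
  "is_attractor M d J g A \<longleftrightarrow>
     A \<in> nonempty_compacts M d \<and> hutchinson J g A = A \<and> (\<exists>U. attracting_nbhd M d J g A U)"

definition basin ::
    "'a set \<Rightarrow> ('a \<Rightarrow> 'a \<Rightarrow> real) \<Rightarrow> 'j set \<Rightarrow> ('j \<Rightarrow> 'a \<Rightarrow> 'a) \<Rightarrow> 'a set \<Rightarrow> 'a set" where
  "basin M d J g A = \<Union>{U. attracting_nbhd M d J g A U}"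

primrec word_comp :: "('j \<Rightarrow> 'a \<Rightarrow> 'a) \<Rightarrow> 'j stream \<Rightarrow> nat \<Rightarrow> 'a \<Rightarrow> 'a" where
  "word_comp g w 0 = id"
| "word_comp g w (Suc k) = word_comp g w k \<circ> g (w !! k)"

definition point_fibred ::
    "'a set \<Rightarrow> ('a \<Rightarrow> 'a \<Rightarrow> real) \<Rightarrow> 'j set \<Rightarrow> ('j \<Rightarrow> 'a \<Rightarrow> 'a) \<Rightarrow> 'a set \<Rightarrow> bool" where
  "point_fibred M d J g A \<longleftrightarrow>
     (\<forall>w\<in>streams J. \<exists>a\<in>A. \<forall>C\<in>nonempty_compacts M d. C \<subseteq> basin M d J g A \<longrightarrow>
        hausdorff_lim M d (\<lambda>k. word_comp g w k ` C) {a})"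

definition fast_basin :: "'a set \<Rightarrow> 'j set \<Rightarrow> ('j \<Rightarrow> 'a \<Rightarrow> 'a) \<Rightarrow> 'a set \<Rightarrow> 'a set" where
  "fast_basin M J g A = {x\<in>M. \<exists>K\<ge>1. (hutchinson J g ^^ K) {x} \<inter> A \<noteq> {}}"


section \<open>The space of reduced words\<close>

text \<open>Letters are nonzero integers, the sign distinguishing \<open>I\<^sub>+\<close> from \<open>I\<^sub>-\<close>. Infinite words are
  streams, so the letter usually written \<open>\<iota>\<^sub>k\<close>, \<open>k \<ge> 1\<close>, is \<open>w !! (k - 1)\<close>.\<close>

definition I_pos :: "nat \<Rightarrow> int set" where
  "I_pos N = {1..int N}"

definition I_neg :: "nat \<Rightarrow> int set" where
  "I_neg N = {- int N..-1}"

definition reduced_words :: "nat \<Rightarrow> int stream set" where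
  "reduced_words N = {w \<in> streams (I_pos N \<union> I_neg N). \<forall>k. w !! k \<noteq> - (w !! Suc k)}"

definition word_dist :: "int stream \<Rightarrow> int stream \<Rightarrow> real" where
  "word_dist v w =
     (if v = w then 0 else (GREATEST r. \<exists>k. v !! k \<noteq> w !! k \<and> r = (1 / 2) ^ Suc k))"

definition sigma_map :: "int \<Rightarrow> int stream \<Rightarrow> int stream" where
  "sigma_map n w = (if shd w = - n then stl w else n ## w)"

definition fast_words_pos :: "nat \<Rightarrow> int stream set" where
  "fast_words_pos N = {w \<in> reduced_words N.
     \<exists>k. \<forall>j. (j < k \<longrightarrow> w !! j \<in> I_neg N) \<and> (k \<le> j \<longrightarrow> w !! j \<in> I_pos N)}"

definition fast_words_neg :: "nat \<Rightarrow> int stream set" where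
  "fast_words_neg N = {w \<in> reduced_words N.
     \<exists>k. \<forall>j. (j < k \<longrightarrow> w !! j \<in> I_pos N) \<and> (k \<le> j \<longrightarrow> w !! j \<in> I_neg N)}"

end

(* Let a word contain a letter of I_+ among its first p + 1 letters. Letters of I_+ put in front of
   it one after another can cancel at most p of its letters: as soon as one of them does not cancel,
   the word starts with a letter of I_+ and no later cancellation is possible. Hence
   sigma_{n_1} ... sigma_{n_k} maps this word to one that starts with n_1 ... n_{k-p}. By compactness
   p is uniform on a compact set disjoint from I_-^infinity, which yields the basin and the fibres;
   on I_-^infinity the maps can cancel forever and the orbit stays away from I_+^infinity.
   The dual system is the same system with the signs of all letters reversed. *)
theory Submission
  imports Defs
begin

section \<open>The metric on words\<close>

lemma word_dist_first_difference:
  assumes "v !! k \<noteq> w !! k" and "\<And>i. i < k \<Longrightarrow> v !! i = w !! i"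
  shows "word_dist v w = (1 / 2) ^ Suc k"
proof -
  have "(GREATEST r. \<exists>j. v !! j \<noteq> w !! j \<and> r = (1 / 2 :: real) ^ Suc j) = (1 / 2) ^ Suc k"
  proof (rule Greatest_equality)
    fix r :: real
    assume "\<exists>j. v !! j \<noteq> w !! j \<and> r = (1 / 2) ^ Suc j"
    then obtain j where j: "v !! j \<noteq> w !! j" "r = (1 / 2) ^ Suc j" by blast
    then have "k \<le> j" using assms(2) by (meson not_le)
    then show "r \<le> (1 / 2) ^ Suc k"
      unfolding j(2) by (intro power_decreasing) auto
  qed (use assms(1) in blast)
  then show ?thesis using assms(1) by (auto simp: word_dist_def)
qed

lemma stream_neq_first_difference:
  assumes "v \<noteq> w"
  obtains k where "v !! k \<noteq> w !! k" "\<And>i. i < k \<Longrightarrow> v !! i = w !! i"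
proof -
  have "\<exists>k. v !! k \<noteq> w !! k"
  proof (rule ccontr)
    assume "\<nexists>k. v !! k \<noteq> w !! k"
    then have "smap id v = w" by (simp add: smap_alt)
    then show False using assms by (simp add: stream.map_id)
  qed
  then show thesis
    using that[of "LEAST k. v !! k \<noteq> w !! k"] by (metis (mono_tags, lifting) LeastI_ex not_less_Least)
qed

text \<open>Letters are counted from 0 while exponents start at 1, so radius
  \<open>(1 / 2) ^ Suc k\<close> means agreement on the first \<open>k\<close> letters. This turns
  metric estimates into statements about common prefixes.\<close>

lemma word_dist_le_iff:
  "word_dist v w \<le> (1 / 2) ^ Suc k \<longleftrightarrow> (\<forall>i<k. v !! i = w !! i)"
proof (cases "v = w")
  case True
  then show ?thesis by (simp add: word_dist_def)
next
  case False
  then obtain j where j: "v !! j \<noteq> w !! j" "\<And>i. i < j \<Longrightarrow> v !! i = w !! i"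
    using stream_neq_first_difference by blast
  have d: "word_dist v w = (1 / 2) ^ Suc j" by (rule word_dist_first_difference[OF j])
  have "word_dist v w \<le> (1 / 2) ^ Suc k \<longleftrightarrow> k \<le> j"
    by (simp add: d del: power_Suc)
  also have "\<dots> \<longleftrightarrow> (\<forall>i<k. v !! i = w !! i)"
    using j by (meson leI less_le_trans)
  finally show ?thesis .
qed

lemma word_dist_pos: "v \<noteq> w \<Longrightarrow> word_dist v w > 0"
  by (metis stream_neq_first_difference word_dist_first_difference zero_less_divide_1_iff
      zero_less_numeral zero_less_power)

lemma word_dist_nonneg: "word_dist v w \<ge> 0"
  using word_dist_pos[of v w] by (cases "v = w") (auto simp: word_dist_def)

lemma word_dist_le_half: "word_dist v w \<le> 1 / 2"
  using word_dist_le_iff[of v w 0] by simp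

lemma word_dist_shd: "shd v \<noteq> shd w \<Longrightarrow> word_dist v w = 1 / 2"
  using word_dist_first_difference[of v 0 w] by simp

text \<open>The stronger ultrametric inequality holds: \<open>u\<close> and \<open>w\<close> agree
  at least up to the earlier of the two first differences.\<close>

lemma word_dist_triangle: "word_dist u w \<le> word_dist u v + word_dist v w"
proof -
  have "word_dist u w \<le> max (word_dist u v) (word_dist v w)"
  proof (cases "u = v \<or> v = w \<or> u = w")
    case True
    then show ?thesis
      using word_dist_nonneg[of u v] word_dist_nonneg[of v w]
      by (auto simp: le_max_iff_disj word_dist_def[of u u] word_dist_def[of v v] word_dist_def[of w w])
  next
    case False
    obtain j where j: "u !! j \<noteq> v !! j" "\<And>i. i < j \<Longrightarrow> u !! i = v !! i"
      using stream_neq_first_difference False by blast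
    obtain k where k: "v !! k \<noteq> w !! k" "\<And>i. i < k \<Longrightarrow> v !! i = w !! i"
      using stream_neq_first_difference False by blast
    have d: "word_dist u v = (1 / 2) ^ Suc j" "word_dist v w = (1 / 2) ^ Suc k"
      using j k by (auto intro: word_dist_first_difference simp del: power_Suc)
    have "word_dist u w \<le> (1 / 2) ^ Suc (min j k)"
      using j k by (simp add: word_dist_le_iff del: power_Suc)
    also have "\<dots> \<le> max (word_dist u v) (word_dist v w)"
      unfolding d by (cases "j \<le> k") (auto simp: min_def le_max_iff_disj)
    finally show ?thesis .
  qed
  then show ?thesis using word_dist_nonneg[of u v] word_dist_nonneg[of v w] by linarith
qed

lemma word_dist_commute: "word_dist v w = word_dist w v"
proof -
  have "(v !! k \<noteq> w !! k) = (w !! k \<noteq> v !! k)" for k by auto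
  then show ?thesis by (simp add: word_dist_def eq_commute[of v w])
qed

lemma Metric_space_word_dist: "Metric_space S word_dist"
proof
  show "word_dist v w = 0 \<longleftrightarrow> v = w" for v w
    using word_dist_pos[of v w] by (auto simp: word_dist_def)
qed (simp_all add: word_dist_nonneg word_dist_commute word_dist_triangle)

text \<open>Strict counterpart of \<open>word_dist_le_iff\<close> for open balls: a first difference
  at \<open>j\<close> gives distance \<open>(1 / 2) ^ Suc j\<close>, so strictness forces
  \<open>k \<le> j\<close>.\<close>

lemma word_dist_less_imp_agree:
  assumes "word_dist v w < (1 / 2) ^ k" and "i < k"
  shows "v !! i = w !! i"
proof (cases k)
  case (Suc l)
  show ?thesis
  proof (cases "v = w")
    case False
    then obtain j where j: "v !! j \<noteq> w !! j" "\<And>i. i < j \<Longrightarrow> v !! i = w !! i"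
      using stream_neq_first_difference by blast
    have d: "word_dist v w = (1 / 2) ^ Suc j" by (rule word_dist_first_difference[OF j])
    have "k < Suc j" using assms(1) by (simp add: d del: power_Suc)
    then show ?thesis using j(2) assms(2) by simp
  qed simp
qed (use assms in simp)

lemma ex_half_power_less:
  fixes e :: real
  assumes "e > 0"
  obtains k where "(1 / 2) ^ Suc k < e"
proof -
  obtain k where "(1 / 2) ^ k < e" using real_arch_pow_inv[OF assms, of "1 / 2"] by auto
  moreover have "(1 / 2 :: real) ^ Suc k \<le> (1 / 2) ^ k" by simp
  ultimately show thesis using that[of k] by linarith
qed

lemma hausdorff_word_dist_le:
  assumes "A \<noteq> {}" "B \<noteq> {}"
    and "\<And>a. a \<in> A \<Longrightarrow> \<exists>b\<in>B. word_dist a b \<le> e"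
    and "\<And>b. b \<in> B \<Longrightarrow> \<exists>a\<in>A. word_dist a b \<le> e"
  shows "hausdorff_dist word_dist A B \<le> e"
  unfolding hausdorff_dist_def
proof (intro max.boundedI cSUP_least assms(1,2))
  fix a assume "a \<in> A"
  then obtain b where "b \<in> B" "word_dist a b \<le> e" using assms(3) by blast
  then show "(INF b\<in>B. word_dist a b) \<le> e"
    by (intro cINF_lower2[where x = b] bdd_belowI2[where m = 0]) (auto simp: word_dist_nonneg)
next
  fix b assume "b \<in> B"
  then obtain a where "a \<in> A" "word_dist a b \<le> e" using assms(4) by blast
  then show "(INF a\<in>A. word_dist a b) \<le> e"
    by (intro cINF_lower2[where x = a] bdd_belowI2[where m = 0]) (auto simp: word_dist_nonneg)
qed

lemma hausdorff_word_dist_ge: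
  assumes "a \<in> A" "B \<noteq> {}" and "\<And>b. b \<in> B \<Longrightarrow> e \<le> word_dist a b"
  shows "e \<le> hausdorff_dist word_dist A B"
proof -
  obtain b0 where b0: "b0 \<in> B" using assms(2) by blast
  \<comment> \<open>A real supremum can be bounded below by one of its terms only if the family is
    bounded above; here the diameter bound 1/2 provides that.\<close>
  have "bdd_above ((\<lambda>a. INF b\<in>B. word_dist a b) ` A)"
  proof (rule bdd_aboveI2)
    fix a
    show "(INF b\<in>B. word_dist a b) \<le> 1 / 2"
      using b0 word_dist_le_half[of a b0]
      by (intro cINF_lower2[where x = b0] bdd_belowI2[where m = 0]) (auto simp: word_dist_nonneg)
  qed
  then have "e \<le> (SUP a\<in>A. INF b\<in>B. word_dist a b)"
    using assms by (intro cSUP_upper2[where x = a] cINF_greatest) auto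
  then show ?thesis by (simp add: hausdorff_dist_def le_max_iff_disj)
qed

text \<open>Common criterion for attraction and for fibres: the prefix shared with the limit set
  grows like \<open>k\<close>, up to a loss \<open>p\<close> independent of \<open>k\<close> and of
  the points. Subtraction is truncated, so nothing is required while
  \<open>k \<le> p\<close>.\<close>

lemma hausdorff_lim_word_distI:
  assumes "\<And>k. S k \<in> nonempty_compacts M word_dist" "A \<in> nonempty_compacts M word_dist"
    and near_A: "\<And>k x. x \<in> S k \<Longrightarrow> \<exists>a\<in>A. \<forall>i < k - p. x !! i = a !! i"
    and near_S: "\<And>k a. a \<in> A \<Longrightarrow> \<exists>x\<in>S k. \<forall>i < k - p. x !! i = a !! i"
  shows "hausdorff_lim M word_dist S A"
proof -
  have ne: "S k \<noteq> {}" "A \<noteq> {}" for k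
    using assms(1)[of k] assms(2) by (auto simp: nonempty_compacts_def)
  have "0 \<le> hausdorff_dist word_dist (S k) A" for k
    using ne by (metis ex_in_conv hausdorff_word_dist_ge word_dist_nonneg)
  moreover have "hausdorff_dist word_dist (S k) A \<le> (1 / 2) ^ Suc (k - p)" for k
    by (rule hausdorff_word_dist_le)
      (use ne near_A[of _ k] near_S[of _ k] in \<open>auto simp: word_dist_le_iff simp del: power_Suc\<close>)
  moreover have "(\<lambda>k. (1 / 2 :: real) ^ Suc (k - p)) \<longlonglongrightarrow> 0"
    by (rule LIMSEQ_offset[where k = p]) (simp add: LIMSEQ_power_zero tendsto_mult_right_zero)
  ultimately have "(\<lambda>k. hausdorff_dist word_dist (S k) A) \<longlonglongrightarrow> 0"
    by (rule tendsto_sandwich[OF always_eventually[OF allI] always_eventually[OF allI] tendsto_const])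
  then show ?thesis using assms(1,2) by (simp add: hausdorff_lim_def)
qed

section \<open>Iterated maps\<close>

text \<open>Both fibre maps and iterates of \<open>hutchinson\<close> are expressed by
  \<open>foldr\<close> over a list of letters, so one prefix estimate serves both. The last letter
  of the list acts first.\<close>

lemma word_comp_foldr: "word_comp g w k = foldr g (stake k w)"
  by (induction k) (simp_all add: stake_Suc del: stake.simps(2))

lemma hutchinson_power:
  "(hutchinson J g ^^ k) C = {foldr g ns x | ns x. ns \<in> lists J \<and> length ns = k \<and> x \<in> C}"
proof (induction k)
  case (Suc k)
  show ?case (is "_ = ?R")
  proof (rule set_eqI, rule iffI)
    fix y assume "y \<in> (hutchinson J g ^^ Suc k) C"
    then obtain n ns x where *: "n \<in> J" "ns \<in> lists J" "length ns = k" "x \<in> C" "y = g n (foldr g ns x)"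
      by (auto simp: Suc hutchinson_def)
    then show "y \<in> ?R" by (intro CollectI exI[of _ "n # ns"] exI[of _ x]) auto
  next
    fix y assume "y \<in> ?R"
    then obtain ns x where *: "ns \<in> lists J" "length ns = Suc k" "x \<in> C" "y = foldr g ns x" by blast
    then obtain n ms where "ns = n # ms" by (cases ns) auto
    with * have "n \<in> J" "y = g n (foldr g ms x)" "foldr g ms x \<in> (hutchinson J g ^^ k) C"
      unfolding Suc by auto
    then show "y \<in> (hutchinson J g ^^ Suc k) C" by (auto simp: hutchinson_def)
  qed
qed auto

section \<open>Words over an alphabet and its negatives\<close>

text \<open>\<open>P\<close> stands for the letters of either sign, so that the system and its dual
  are two instances. The last assumption also keeps 0 out of \<open>P\<close>.\<close>

locale letters =
  fixes P :: "int set"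
  assumes finite_P: "finite P" and P_nonempty: "P \<noteq> {}"
    and P_disjoint: "n \<in> P \<Longrightarrow> - n \<notin> P"
begin

section \<open>Reduced words over \<open>P\<close> and its negatives\<close>

definition red :: "int stream set" where
  "red = {w \<in> streams (P \<union> uminus ` P). \<forall>k. w !! k \<noteq> - (w !! Suc k)}"

sublocale Metric_space red word_dist
  by (rule Metric_space_word_dist)

lemma mem_uminus_image [simp]: "n \<in> uminus ` P \<longleftrightarrow> - n \<in> P"
  by force

lemma red_iff: "w \<in> red \<longleftrightarrow> (\<forall>k. (w !! k \<in> P \<or> - (w !! k) \<in> P) \<and> w !! k \<noteq> - (w !! Suc k))"
  by (auto simp: red_def streams_iff_snth)

lemma red_Stream:
  "n ## w \<in> red \<longleftrightarrow> (n \<in> P \<or> - n \<in> P) \<and> n \<noteq> - shd w \<and> w \<in> red"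
proof
  assume L: "n ## w \<in> red"
  from L[unfolded red_iff] have *: "((n ## w) !! k \<in> P \<or> - ((n ## w) !! k) \<in> P) \<and>
    (n ## w) !! k \<noteq> - ((n ## w) !! Suc k)" for k by blast
  from *[of 0] *[of "Suc _"] show "(n \<in> P \<or> - n \<in> P) \<and> n \<noteq> - shd w \<and> w \<in> red"
    by (simp add: red_iff)
next
  assume R: "(n \<in> P \<or> - n \<in> P) \<and> n \<noteq> - shd w \<and> w \<in> red"
  show "n ## w \<in> red"
    unfolding red_iff
  proof
    fix k
    show "((n ## w) !! k \<in> P \<or> - ((n ## w) !! k) \<in> P) \<and> (n ## w) !! k \<noteq> - ((n ## w) !! Suc k)"
      using R by (cases k) (auto simp: red_iff)
  qed
qed

lemma red_letter_cases: "w \<in> red \<Longrightarrow> - (w !! k) \<in> P \<longleftrightarrow> w !! k \<notin> P"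
  using P_disjoint red_iff by blast

lemma streams_subset_red: "streams P \<subseteq> red"
proof
  fix w assume "w \<in> streams P"
  then have "w !! k \<in> P" for k by (simp add: streams_iff_snth)
  then show "w \<in> red" unfolding red_iff using P_disjoint by metis
qed

section \<open>The maps as homeomorphisms, and their inverses\<close>

lemma sigma_in_red:
  assumes "n \<in> P \<or> - n \<in> P" "w \<in> red"
  shows "sigma_map n w \<in> red"
  using assms red_Stream[of "shd w" "stl w"] by (auto simp: sigma_map_def red_Stream)

lemma sigma_inverse:
  assumes "w \<in> red"
  shows "sigma_map (- n) (sigma_map n w) = w"
proof -
  \<comment> \<open>After a cancellation the inverse map must put the letter back instead of
    cancelling again; reducedness of \<open>w\<close> guarantees this.\<close>
  have "shd (stl w) \<noteq> n" if "shd w = - n"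
    using assms that red_iff[of w] by (metis minus_minus snth.simps(1) snth.simps(2))
  then show ?thesis by (auto simp: sigma_map_def) (metis stream.collapse)
qed

text \<open>If the first letters agree, both words take the same branch of \<open>sigma_map\<close>,
  and at most one letter of the common prefix is lost. If they differ, the right-hand side is 1 and
  the bound is trivial.\<close>

lemma sigma_Lipschitz: "word_dist (sigma_map n v) (sigma_map n w) \<le> 2 * word_dist v w"
proof (cases "v = w")
  case False
  then obtain k where k: "v !! k \<noteq> w !! k" "\<And>i. i < k \<Longrightarrow> v !! i = w !! i"
    using stream_neq_first_difference by blast
  have d: "word_dist v w = (1 / 2) ^ Suc k" by (rule word_dist_first_difference[OF k])
  show ?thesis
  proof (cases k)
    case 0
    then show ?thesis using d word_dist_le_half[of "sigma_map n v" "sigma_map n w"] by simp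
  next
    case (Suc l)
    have "shd v = shd w" using k(2)[of 0] Suc by simp
    moreover have "stl v !! i = stl w !! i" if "i < l" for i using k(2)[of "Suc i"] Suc that by simp
    moreover have "(n ## v) !! i = (n ## w) !! i" if "i < l" for i
      using k(2)[of "i - 1"] Suc that by (cases i) auto
    ultimately have "word_dist (sigma_map n v) (sigma_map n w) \<le> (1 / 2) ^ Suc l"
      by (simp add: word_dist_le_iff sigma_map_def del: power_Suc snth.simps)
    then show ?thesis using d Suc by simp
  qed
qed (simp add: word_dist_def)

lemma continuous_sigma:
  assumes "n \<in> P \<or> - n \<in> P"
  shows "continuous_map mtopology mtopology (sigma_map n)"
  unfolding continuous_map_to_metric
proof (intro ballI allI impI)
  fix x and e :: real
  assume x: "x \<in> topspace mtopology" and "e > 0"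
  have "\<forall>y\<in>mball x (e / 2). sigma_map n y \<in> mball (sigma_map n x) e"
  proof
    fix y assume "y \<in> mball x (e / 2)"
    then show "sigma_map n y \<in> mball (sigma_map n x) e"
      using sigma_Lipschitz[of n x y] sigma_in_red[OF assms] by auto
  qed
  then show "\<exists>U. openin mtopology U \<and> x \<in> U \<and> (\<forall>y\<in>U. sigma_map n y \<in> mball (sigma_map n x) e)"
    using x \<open>e > 0\<close> by (intro exI[of _ "mball x (e / 2)"]) auto
qed

lemma homeomorphic_sigma:
  assumes "n \<in> P \<or> - n \<in> P"
  shows "homeomorphic_map mtopology mtopology (sigma_map n)"
proof -
  have "homeomorphic_maps mtopology mtopology (sigma_map n) (sigma_map (- n))"
    using assms continuous_sigma[of n] continuous_sigma[of "- n"] sigma_inverse[of _ n] sigma_inverse[of _ "- n"]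
    by (auto simp: homeomorphic_maps_def)
  then show ?thesis using homeomorphic_map_maps by blast
qed

lemma dual_maps_sigma:
  assumes "n \<in> P \<or> - n \<in> P" "w \<in> red"
  shows "sigma_map (- n) w = dual_maps red sigma_map n w"
proof -
  have "inj_on (sigma_map n) red" by (rule inj_on_inverseI[where g = "sigma_map (- n)"]) (rule sigma_inverse)
  moreover have "sigma_map n (sigma_map (- n) w) = w" using sigma_inverse[of w "- n"] assms by simp
  moreover have "sigma_map (- n) w \<in> red" using assms by (intro sigma_in_red) auto
  ultimately show ?thesis unfolding dual_maps_def by (metis inv_into_f_f)
qed

section \<open>Completeness, compactness and open sets of words\<close>

lemma mcomplete_red: "mcomplete"
  unfolding mcomplete_def
proof (intro allI impI)
  fix s assume s: "MCauchy s"
  then have range: "s n \<in> red" for n by (auto simp: MCauchy_def)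
  have "\<exists>N. \<forall>n n'. N \<le> n \<longrightarrow> N \<le> n' \<longrightarrow> word_dist (s n) (s n') < (1 / 2) ^ k" for k
    using s by (simp add: MCauchy_def)
  then obtain L where L: "\<And>k n n'. L k \<le> n \<Longrightarrow> L k \<le> n' \<Longrightarrow> word_dist (s n) (s n') < (1 / 2) ^ k"
    by metis
  \<comment> \<open>The letter at index \<open>i\<close> no longer changes from
    \<open>s (L (Suc i))\<close> on, so the limit can be read off letter by letter.\<close>
  define x where "x = smap (\<lambda>i. s (L (Suc i)) !! i) nats"
  have x: "x !! i = s n !! i" if "L (Suc i) \<le> n" for i n
    using word_dist_less_imp_agree[OF L[of "Suc i" "L (Suc i)" n], of i] that by (simp add: x_def)
  have x_red: "x \<in> red"
    unfolding red_iff
  proof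
    fix k
    \<comment> \<open>Reducedness concerns two neighbouring letters, so both are read from a single
      late term of the sequence.\<close>
    define n where "n = max (L (Suc k)) (L (Suc (Suc k)))"
    then have "x !! k = s n !! k" "x !! Suc k = s n !! Suc k" by (auto simp: x simp del: snth.simps)
    then show "(x !! k \<in> P \<or> - (x !! k) \<in> P) \<and> x !! k \<noteq> - (x !! Suc k)"
      using range[of n] by (simp add: red_iff del: snth.simps)
  qed
  have "limitin mtopology s x sequentially"
    unfolding limitin_metric
  proof (intro conjI allI impI x_red)
    fix e :: real assume "e > 0"
    then obtain k where k: "(1 / 2) ^ Suc k < e" by (rule ex_half_power_less)
    \<comment> \<open>\<open>L\<close> need not be monotone, hence the maximum.\<close>
    have "s n \<in> red \<and> word_dist (s n) x < e" if "n \<ge> Max (L ` {..k})" for n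
    proof -
      have "L (Suc i) \<le> n" if "i < k" for i
        using \<open>n \<ge> Max (L ` {..k})\<close> that by (meson Max_ge Suc_leI atMost_iff finite_atMost finite_imageI image_eqI le_trans)
      then have "word_dist (s n) x \<le> (1 / 2) ^ Suc k" unfolding word_dist_le_iff using x by metis
      then show ?thesis using k range by simp
    qed
    then show "\<forall>\<^sub>F n in sequentially. s n \<in> red \<and> word_dist (s n) x < e"
      unfolding eventually_sequentially by blast
  qed
  then show "\<exists>x. limitin mtopology s x sequentially" by blast
qed

lemma mtotally_bounded_red: "mtotally_bounded red"
  unfolding mtotally_bounded_def
proof (intro allI impI)
  fix e :: real assume "e > 0"
  then obtain k where k: "(1 / 2) ^ Suc k < e" by (rule ex_half_power_less)
  \<comment> \<open>One reduced word is chosen for each prefix of length \<open>k\<close>; there are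
    finitely many prefixes because \<open>P\<close> is finite.\<close>
  define K where "K = inv_into red (stake k) ` stake k ` red"
  have "stake k w \<in> {xs. set xs \<subseteq> P \<union> uminus ` P \<and> length xs = k}" if "w \<in> red" for w
    using that by (force simp: red_letter_cases in_set_conv_nth)
  then have "stake k ` red \<subseteq> {xs. set xs \<subseteq> P \<union> uminus ` P \<and> length xs = k}" by blast
  then have "finite K"
    unfolding K_def
    by (intro finite_imageI finite_subset[OF _ finite_lists_length_eq[of "P \<union> uminus ` P" k]])
      (use finite_P in auto)
  moreover have "K \<subseteq> red" by (auto simp: K_def inv_into_into)
  moreover have "red \<subseteq> (\<Union>x\<in>K. mball x e)"
  proof
    fix w assume w: "w \<in> red"
    define v where "v = inv_into red (stake k) (stake k w)"
    have "v \<in> K" "v \<in> red" using w by (auto simp: K_def v_def inv_into_into)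
    have "stake k v = stake k w" using w by (simp add: v_def f_inv_into_f)
    then have "\<forall>i<k. v !! i = w !! i" by (metis stake_nth)
    then have "word_dist v w < e" using k word_dist_le_iff[of v w k] le_less_trans by blast
    then show "w \<in> (\<Union>x\<in>K. mball x e)" using \<open>v \<in> K\<close> \<open>v \<in> red\<close> w by auto
  qed
  ultimately show "\<exists>K. finite K \<and> K \<subseteq> red \<and> red \<subseteq> (\<Union>x\<in>K. mball x e)" by blast
qed

lemma compact_space_red: "compact_space mtopology"
  using compact_space_eq_mcomplete_mtotally_bounded mcomplete_red mtotally_bounded_red by blast

text \<open>A small ball fixes the letter at a witnessing index. With \<open>S = UNIV\<close> this
  handles complements of sets of one-signed words, with \<open>S = {..m}\<close> the cover used for
  the uniform bound.\<close>

lemma openin_letter_occurs: "openin mtopology {w \<in> red. \<exists>i\<in>S. w !! i \<in> X}"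
  unfolding openin_mtopology
proof (intro conjI allI impI)
  fix w assume "w \<in> {w \<in> red. \<exists>i\<in>S. w !! i \<in> X}"
  then obtain i where i: "i \<in> S" "w !! i \<in> X" by blast
  have "mball w ((1 / 2) ^ Suc i) \<subseteq> {w \<in> red. \<exists>i\<in>S. w !! i \<in> X}"
  proof
    fix v assume v: "v \<in> mball w ((1 / 2) ^ Suc i)"
    then have "w !! i = v !! i" by (intro word_dist_less_imp_agree[of w v "Suc i"]) auto
    then show "v \<in> {w \<in> red. \<exists>i\<in>S. w !! i \<in> X}" using v i by auto
  qed
  then show "\<exists>r>0. mball w r \<subseteq> {w \<in> red. \<exists>i\<in>S. w !! i \<in> X}"
    by (intro exI[of _ "(1 / 2) ^ Suc i"]) auto
qed auto

lemma red_minus_negative: "red - streams (uminus ` P) = {w \<in> red. \<exists>i. w !! i \<in> P}"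
  by (auto simp: streams_iff_snth red_letter_cases)

lemma streams_nonempty_compact: "streams P \<in> nonempty_compacts red word_dist"
proof -
  have "red - streams P = {w \<in> red. \<exists>i\<in>UNIV. w !! i \<in> - P}"
    by (auto simp: streams_iff_snth)
  then have "openin mtopology (red - streams P)"
    using openin_letter_occurs[of UNIV "- P"] by (simp only:)
  then have "closedin mtopology (streams P)" using streams_subset_red by (simp add: closedin_def)
  then have "compactin mtopology (streams P)" by (rule closedin_compact_space[OF compact_space_red])
  moreover have "streams P \<noteq> {}" using P_nonempty sconst_streams by fastforce
  ultimately show ?thesis by (simp add: nonempty_compacts_def)
qed

text \<open>The sets \<open>?V m\<close> are open and cover \<open>C\<close>, as a reduced word that
  is not entirely negative has a letter in \<open>P\<close>. The largest index in a finite subcover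
  is the bound \<open>p\<close>.\<close>

lemma compact_letter_bound:
  assumes "C \<in> nonempty_compacts red word_dist" "C \<subseteq> red - streams (uminus ` P)"
  obtains p where "\<And>x. x \<in> C \<Longrightarrow> \<exists>i\<le>p. x !! i \<in> P"
proof -
  let ?V = "\<lambda>m. {w \<in> red. \<exists>i\<in>{..m}. w !! i \<in> P}"
  have "compactin mtopology C" using assms(1) by (simp add: nonempty_compacts_def)
  moreover have "\<forall>U\<in>range ?V. openin mtopology U" using openin_letter_occurs by blast
  moreover have "C \<subseteq> \<Union> (range ?V)" using assms(2) unfolding red_minus_negative by fastforce
  ultimately obtain F where F: "finite F" "F \<subseteq> range ?V" "C \<subseteq> \<Union>F"
    using compactinD[of mtopology C "range ?V"] by (metis (no_types, lifting))
  then obtain T where T: "finite T" "F = ?V ` T" using finite_subset_image[OF F(1,2)] by blast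
  have "\<exists>i\<le>Max T. x !! i \<in> P" if x: "x \<in> C" for x
  proof -
    obtain m i where "m \<in> T" "i \<le> m" "x !! i \<in> P" using F(3) x unfolding T(2) by fastforce
    moreover have "m \<le> Max T" using T(1) \<open>m \<in> T\<close> by simp
    ultimately show ?thesis using le_trans by blast
  qed
  then show thesis by (rule that)
qed

section \<open>How far cancellation can reach\<close>

lemma foldr_sigma_no_cancel:
  assumes "ns \<in> lists P" "shd x \<in> P"
  shows "foldr sigma_map ns x = ns @- x"
  using assms(1)
proof (induction ns)
  case (Cons n ns)
  have "shd (ns @- x) \<in> P" using Cons assms(2) by (cases ns) auto
  then show ?case using Cons P_disjoint by (auto simp: sigma_map_def)
qed simp

text \<open>Reverse induction, because the last letter of the list acts first. A cancellation
  shortens the list and lowers \<open>p\<close> by one each, leaving \<open>length ns - p\<close>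
  unchanged; without cancellation the word starts in \<open>P\<close> and the whole list is simply
  prepended.\<close>

lemma foldr_sigma_prefix:
  assumes "ns \<in> lists P" "x !! p \<in> P" "i < length ns - p"
  shows "foldr sigma_map ns x !! i = ns ! i"
  using assms
proof (induction ns arbitrary: x p rule: rev_induct)
  case (snoc n ns)
  show ?case
  proof (cases "shd x = - n")
    case True
    \<comment> \<open>With \<open>p = 0\<close> the first letter of \<open>x\<close> would lie in
      \<open>P\<close>, and \<open>n\<close> could not cancel it.\<close>
    then obtain q where q: "p = Suc q" using snoc.prems P_disjoint by (cases p) auto
    have "foldr sigma_map ns (stl x) !! i = ns ! i"
      by (rule snoc.IH[of "stl x" q]) (use snoc.prems q in auto)
    moreover have "sigma_map n x = stl x" using True by (simp add: sigma_map_def)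
    ultimately show ?thesis using snoc.prems(3) q by (auto simp: nth_append)
  next
    case False
    then have "foldr sigma_map (ns @ [n]) x = ns @- n ## x"
      using snoc.prems by (simp add: sigma_map_def foldr_sigma_no_cancel)
    also have "\<dots> = (ns @ [n]) @- x" by simp
    finally show ?thesis using snoc.prems(3) by (simp del: shift_append)
  qed
qed simp

lemma foldr_sigma_prefix_bound:
  assumes "ns \<in> lists P" "\<exists>j\<le>p. x !! j \<in> P" "i < length ns - p"
  shows "foldr sigma_map ns x !! i = ns ! i"
proof -
  obtain j where "j \<le> p" "x !! j \<in> P" using assms(2) by blast
  then show ?thesis using assms(1,3) by (intro foldr_sigma_prefix[where p = j]) auto
qed

section \<open>Convergence of the iterates\<close>

lemma foldr_sigma_nonempty_compact:
  assumes "ns \<in> lists P" "C \<in> nonempty_compacts red word_dist"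
  shows "foldr sigma_map ns ` C \<in> nonempty_compacts red word_dist"
  using assms(1)
proof (induction ns)
  case (Cons n ns)
  then have "sigma_map n ` foldr sigma_map ns ` C \<in> nonempty_compacts red word_dist"
    using image_compactin continuous_sigma by (fastforce simp: nonempty_compacts_def)
  then show ?case by (simp add: image_comp)
qed (use assms in simp)

lemma hutchinson_nonempty_compact:
  assumes "C \<in> nonempty_compacts red word_dist"
  shows "hutchinson P sigma_map C \<in> nonempty_compacts red word_dist"
proof -
  have "compactin mtopology (\<Union>n\<in>P. sigma_map n ` C)"
    using assms image_compactin continuous_sigma
    by (intro compactin_Union finite_imageI finite_P) (fastforce simp: nonempty_compacts_def)
  then show ?thesis using assms P_nonempty by (auto simp: nonempty_compacts_def hutchinson_def)
qed

lemma hutchinson_power_nonempty_compact: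
  assumes "C \<in> nonempty_compacts red word_dist"
  shows "(hutchinson P sigma_map ^^ k) C \<in> nonempty_compacts red word_dist"
  using assms by (induction k) (auto intro: hutchinson_nonempty_compact)

lemma stake_in_lists: "w \<in> streams P \<Longrightarrow> stake k w \<in> lists P"
  by (auto simp: in_set_conv_nth streams_iff_snth)

lemma hutchinson_lim:
  assumes "C \<in> nonempty_compacts red word_dist" "C \<subseteq> red - streams (uminus ` P)"
  shows "hausdorff_lim red word_dist (\<lambda>k. (hutchinson P sigma_map ^^ k) C) (streams P)"
proof -
  obtain p where p: "\<And>x. x \<in> C \<Longrightarrow> \<exists>i\<le>p. x !! i \<in> P" using compact_letter_bound[OF assms] by blast
  obtain c where c: "c \<in> P" using P_nonempty by blast
  obtain x0 where x0: "x0 \<in> C" using assms(1) by (auto simp: nonempty_compacts_def)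
  show ?thesis
  proof (rule hausdorff_lim_word_distI[where p = p])
    fix k x assume "x \<in> (hutchinson P sigma_map ^^ k) C"
    then obtain ns y where *: "ns \<in> lists P" "length ns = k" "y \<in> C" "x = foldr sigma_map ns y"
      unfolding hutchinson_power by blast
    \<comment> \<open>Any continuation by letters of \<open>P\<close> would do: only the prefix
      \<open>ns\<close> matters for closeness.\<close>
    have "ns @- sconst c \<in> streams P" using * c by (intro shift_streams sconst_streams)
    moreover have "\<forall>i<k - p. x !! i = (ns @- sconst c) !! i"
      using foldr_sigma_prefix_bound[OF *(1) p[OF *(3)]] * by simp
    ultimately show "\<exists>a\<in>streams P. \<forall>i<k - p. x !! i = a !! i" by blast
  next
    fix k a assume a: "a \<in> streams P"
    \<comment> \<open>Conversely, applying the first \<open>k\<close> letters of \<open>a\<close> to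
      a fixed point of \<open>C\<close> approximates \<open>a\<close>.\<close>
    have "foldr sigma_map (stake k a) x0 \<in> (hutchinson P sigma_map ^^ k) C"
      unfolding hutchinson_power using x0 stake_in_lists[OF a] by force
    moreover have "\<forall>i<k - p. foldr sigma_map (stake k a) x0 !! i = a !! i"
      using foldr_sigma_prefix_bound[OF stake_in_lists[OF a] p[OF x0]] by simp
    ultimately show "\<exists>x\<in>(hutchinson P sigma_map ^^ k) C. \<forall>i<k - p. x !! i = a !! i" by blast
  qed (use assms streams_nonempty_compact hutchinson_power_nonempty_compact in auto)
qed

section \<open>The basin\<close>

lemma attracting_nbhd_red_minus_negative:
  "attracting_nbhd red word_dist P sigma_map (streams P) (red - streams (uminus ` P))"
proof -
  have "openin mtopology (red - streams (uminus ` P))"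
    using openin_letter_occurs[of UNIV P] by (simp add: red_minus_negative)
  moreover have "streams P \<subseteq> red - streams (uminus ` P)"
    unfolding red_minus_negative using streams_subset_red snth_in by blast
  ultimately show ?thesis using hutchinson_lim by (simp add: attracting_nbhd_def)
qed

text \<open>The reversal makes the inverse of the first letter of \<open>x\<close> act first, so
  that every step cancels. This shows both that negative words escape attraction and that words with
  a finite negative prefix reach the attractor.\<close>

lemma foldr_sigma_cancel:
  "foldr sigma_map (rev (map uminus (stake k x))) x = sdrop k x"
  by (induction k arbitrary: x) (simp_all add: sigma_map_def)

lemma sdrop_in_hutchinson_power:
  assumes "rev (map uminus (stake k x)) \<in> lists P"
  shows "sdrop k x \<in> (hutchinson P sigma_map ^^ k) {x}"
  unfolding hutchinson_power
  using assms by (intro CollectI exI[of _ "rev (map uminus (stake k x))"] exI[of _ x] conjI)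
    (simp_all only: foldr_sigma_cancel length_rev length_map length_stake singletonI)

text \<open>For a negative word \<open>x\<close>, the compact set \<open>{x}\<close> is not
  attracted: its iterates always contain a tail of \<open>x\<close>, whose negative first letter
  puts it at distance 1/2 from every word over \<open>P\<close>.\<close>

lemma attracting_nbhd_disjoint_negative:
  assumes "attracting_nbhd red word_dist P sigma_map (streams P) U"
  shows "U \<subseteq> red - streams (uminus ` P)"
proof
  fix x assume x: "x \<in> U"
  then have "x \<in> red" using assms openin_subset by (fastforce simp: attracting_nbhd_def)
  moreover have "x \<notin> streams (uminus ` P)"
  proof
    assume neg: "x \<in> streams (uminus ` P)"
    have "{x} \<in> nonempty_compacts red word_dist" using \<open>x \<in> red\<close> by (simp add: nonempty_compacts_def)
    then have lim: "(\<lambda>k. hausdorff_dist word_dist ((hutchinson P sigma_map ^^ k) {x}) (streams P)) \<longlonglongrightarrow> 0"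
      using assms x by (simp add: attracting_nbhd_def hausdorff_lim_def)
    have "1 / 2 \<le> hausdorff_dist word_dist ((hutchinson P sigma_map ^^ k) {x}) (streams P)" for k
    proof (rule hausdorff_word_dist_ge)
      have "rev (map uminus (stake k x)) \<in> lists P"
        using neg by (auto simp: in_set_conv_nth streams_iff_snth)
      then show "sdrop k x \<in> (hutchinson P sigma_map ^^ k) {x}"
        by (rule sdrop_in_hutchinson_power)
      show "streams P \<noteq> {}" using streams_nonempty_compact by (simp add: nonempty_compacts_def)
      fix b assume "b \<in> streams P"
      moreover have "- shd (sdrop k x) \<in> P" using snth_in[OF neg, of k] by simp
      ultimately have "shd (sdrop k x) \<noteq> shd b" using P_disjoint streams_shd by metis
      then show "1 / 2 \<le> word_dist (sdrop k x) b" by (simp add: word_dist_shd)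
    qed
    then have "1 / 2 \<le> (0 :: real)" by (intro LIMSEQ_le_const[OF lim]) auto
    then show False by simp
  qed
  ultimately show "x \<in> red - streams (uminus ` P)" by blast
qed

lemma basin_sigma: "basin red word_dist P sigma_map (streams P) = red - streams (uminus ` P)"
  using attracting_nbhd_red_minus_negative attracting_nbhd_disjoint_negative
  unfolding basin_def by blast

section \<open>The attractor and its fibres\<close>

lemma is_ifs_sigma: "is_ifs red word_dist P sigma_map"
  using Metric_space_word_dist mcomplete_red finite_P homeomorphic_sigma by (simp add: is_ifs_def)

lemma hutchinson_streams: "hutchinson P sigma_map (streams P) = streams P"
proof
  show "hutchinson P sigma_map (streams P) \<subseteq> streams P"
    by (auto simp: hutchinson_def sigma_map_def streams_stl)
  show "streams P \<subseteq> hutchinson P sigma_map (streams P)"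
  proof
    fix w assume w: "w \<in> streams P"
    then have *: "shd w \<in> P" "stl w \<in> streams P" "shd (stl w) \<in> P"
      by (auto intro: streams_shd streams_stl)
    then have "w = sigma_map (shd w) (stl w)" using P_disjoint by (auto simp: sigma_map_def)
    then show "w \<in> hutchinson P sigma_map (streams P)" using * by (auto simp: hutchinson_def)
  qed
qed

lemma is_attractor_sigma: "is_attractor red word_dist P sigma_map (streams P)"
  using streams_nonempty_compact hutchinson_streams attracting_nbhd_red_minus_negative
  by (auto simp: is_attractor_def)

lemma point_fibred_sigma: "point_fibred red word_dist P sigma_map (streams P)"
  unfolding point_fibred_def basin_sigma
\<comment> \<open>The fibre point with address \<open>w\<close> is \<open>w\<close> itself.\<close>
proof (intro ballI bexI impI)
  fix w C
  assume w: "w \<in> streams P"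
    and C: "C \<in> nonempty_compacts red word_dist" "C \<subseteq> red - streams (uminus ` P)"
  obtain p where p: "\<And>x. x \<in> C \<Longrightarrow> \<exists>i\<le>p. x !! i \<in> P" using compact_letter_bound[OF C] by blast
  have prefix: "\<forall>i<k - p. foldr sigma_map (stake k w) x !! i = w !! i" if "x \<in> C" for x k
    using foldr_sigma_prefix_bound[OF stake_in_lists[OF w] p[OF that]] by simp
  have "C \<noteq> {}" using C(1) by (simp add: nonempty_compacts_def)
  show "hausdorff_lim red word_dist (\<lambda>k. word_comp sigma_map w k ` C) {w}"
    unfolding word_comp_foldr
  proof (rule hausdorff_lim_word_distI[where p = p])
    show "{w} \<in> nonempty_compacts red word_dist"
      using w streams_subset_red by (auto simp: nonempty_compacts_def)
    show "foldr sigma_map (stake k w) ` C \<in> nonempty_compacts red word_dist" for k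
      by (intro foldr_sigma_nonempty_compact stake_in_lists w C)
  qed (use prefix \<open>C \<noteq> {}\<close> in auto)
qed

section \<open>The fast basin\<close>

definition fast_words :: "int stream set" where
  "fast_words = {w \<in> red.
     \<exists>k. \<forall>j. (j < k \<longrightarrow> w !! j \<in> uminus ` P) \<and> (k \<le> j \<longrightarrow> w !! j \<in> P)}"

lemma fast_words_iff:
  "w \<in> fast_words \<longleftrightarrow> w \<in> red \<and> (\<exists>k. stake k w \<in> lists (uminus ` P) \<and> sdrop k w \<in> streams P)"
proof -
  have "stake k w \<in> lists (uminus ` P) \<longleftrightarrow> (\<forall>j<k. w !! j \<in> uminus ` P)" for k
    unfolding in_lists_conv_set by (metis in_set_conv_nth length_stake stake_nth)
  moreover have "sdrop k w \<in> streams P \<longleftrightarrow> (\<forall>j\<ge>k. w !! j \<in> P)" for k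
    by (auto simp: streams_iff_snth sdrop_snth) (metis le_add_diff_inverse)
  ultimately show ?thesis by (auto simp: fast_words_def)
qed

text \<open>If \<open>n\<close> cancels, \<open>x\<close> has one more negative letter in front than
  its image. Otherwise the image starts with \<open>n\<close> in \<open>P\<close>, so its negative
  prefix is empty and \<open>x\<close> is a word over \<open>P\<close>.\<close>

lemma fast_words_sigma_backward:
  assumes "n \<in> P" "x \<in> red" "sigma_map n x \<in> fast_words"
  shows "x \<in> fast_words"
proof -
  obtain k where k: "stake k (sigma_map n x) \<in> lists (uminus ` P)" "sdrop k (sigma_map n x) \<in> streams P"
    using assms(3) fast_words_iff by blast
  show ?thesis
  proof (cases "shd x = - n")
    case True
    then have "stake (Suc k) x \<in> lists (uminus ` P)" "sdrop (Suc k) x \<in> streams P"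
      using k assms(1) by (auto simp: sigma_map_def)
    then show ?thesis using assms(2) fast_words_iff by blast
  next
    case False
    then have "k = 0" using k(1) assms(1) P_disjoint by (cases k) (auto simp: sigma_map_def)
    then have "x \<in> streams P" using k(2) False by (simp add: sigma_map_def streams_Stream)
    then show ?thesis using assms(2) fast_words_iff by (metis lists.Nil sdrop.simps(1) stake.simps(1))
  qed
qed

lemma foldr_sigma_in_red: "ns \<in> lists P \<Longrightarrow> x \<in> red \<Longrightarrow> foldr sigma_map ns x \<in> red"
  by (induction ns) (auto intro: sigma_in_red)

lemma fast_words_foldr_backward:
  assumes "ns \<in> lists P" "x \<in> red" "foldr sigma_map ns x \<in> fast_words"
  shows "x \<in> fast_words"
  using assms by (induction ns) (auto intro: fast_words_sigma_backward foldr_sigma_in_red)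

lemma fast_basin_sigma: "fast_basin red P sigma_map (streams P) = fast_words"
proof (rule set_eqI, rule iffI)
  fix x assume "x \<in> fast_basin red P sigma_map (streams P)"
  then obtain ns where *: "x \<in> red" "ns \<in> lists P" "foldr sigma_map ns x \<in> streams P"
    unfolding fast_basin_def hutchinson_power by blast
  then have "foldr sigma_map ns x \<in> fast_words"
    using streams_subset_red fast_words_iff by (metis lists.Nil sdrop.simps(1) stake.simps(1) subsetD)
  then show "x \<in> fast_words" using * fast_words_foldr_backward by blast
next
  fix x assume "x \<in> fast_words"
  then obtain k where k: "x \<in> red" "stake k x \<in> lists (uminus ` P)" "sdrop k x \<in> streams P"
    using fast_words_iff by blast
  have "rev (map uminus (stake k x)) \<in> lists P" using k(2) by auto
  then have "sdrop k x \<in> (hutchinson P sigma_map ^^ k) {x}"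
    by (rule sdrop_in_hutchinson_power)
  \<comment> \<open>The fast basin asks for at least one iteration, but \<open>k\<close> may be 0;
    one further map is harmless since it keeps words over \<open>P\<close> in that set.\<close>
  moreover obtain n where "n \<in> P" using P_nonempty by blast
  ultimately have "sigma_map n (sdrop k x) \<in> (hutchinson P sigma_map ^^ Suc k) {x}"
    by (auto simp: hutchinson_def)
  moreover have "sigma_map n (sdrop k x) \<in> streams P"
    using k(3) \<open>n \<in> P\<close> hutchinson_streams by (auto simp: hutchinson_def)
  ultimately show "x \<in> fast_basin red P sigma_map (streams P)"
    using k(1) unfolding fast_basin_def by (intro CollectI conjI exI[of _ "Suc k"]) auto
qed

end

theorem theorem5p3:
  fixes N :: nat
  assumes "N \<ge> 1"
  shows
   "(is_ifs (reduced_words N) word_dist (I_pos N) sigma_map \<and>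
     is_attractor (reduced_words N) word_dist (I_pos N) sigma_map (streams (I_pos N)) \<and>
     point_fibred (reduced_words N) word_dist (I_pos N) sigma_map (streams (I_pos N)) \<and>
     basin (reduced_words N) word_dist (I_pos N) sigma_map (streams (I_pos N)) =
       reduced_words N - streams (I_neg N) \<and>
     fast_basin (reduced_words N) (I_pos N) sigma_map (streams (I_pos N)) = fast_words_pos N) \<and>
    (I_neg N = uminus ` I_pos N \<and>
     (\<forall>n\<in>I_pos N. \<forall>w\<in>reduced_words N.
        sigma_map (- n) w = dual_maps (reduced_words N) sigma_map n w) \<and>
     is_ifs (reduced_words N) word_dist (I_neg N) sigma_map \<and>
     is_attractor (reduced_words N) word_dist (I_neg N) sigma_map (streams (I_neg N)) \<and>
     point_fibred (reduced_words N) word_dist (I_neg N) sigma_map (streams (I_neg N)) \<and>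
     basin (reduced_words N) word_dist (I_neg N) sigma_map (streams (I_neg N)) =
       reduced_words N - streams (I_pos N) \<and>
     fast_basin (reduced_words N) (I_neg N) sigma_map (streams (I_neg N)) = fast_words_neg N)"
proof -
  have neg: "I_neg N = uminus ` I_pos N" by (simp add: I_neg_def I_pos_def)
  have pos: "I_pos N = uminus ` I_neg N" by (simp add: I_neg_def I_pos_def)
  \<comment> \<open>The two instances give the two halves of the claim; \<open>N \<ge> 1\<close>
    makes the alphabets nonempty.\<close>
  interpret p: letters "I_pos N" by unfold_locales (use assms in \<open>auto simp: I_pos_def\<close>)
  interpret n: letters "I_neg N" by unfold_locales (use assms in \<open>auto simp: I_neg_def\<close>)
  have red: "p.red = reduced_words N" "n.red = reduced_words N"
    by (simp_all add: p.red_def n.red_def reduced_words_def Un_commute flip: neg pos)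
  have fast: "p.fast_words = fast_words_pos N" "n.fast_words = fast_words_neg N"
    by (simp_all add: p.fast_words_def n.fast_words_def fast_words_pos_def fast_words_neg_def red
        flip: neg pos)
  show ?thesis
    using p.is_ifs_sigma p.is_attractor_sigma p.point_fibred_sigma p.basin_sigma p.fast_basin_sigma
      n.is_ifs_sigma n.is_attractor_sigma n.point_fibred_sigma n.basin_sigma n.fast_basin_sigma
      p.dual_maps_sigma
    unfolding red fast by (simp flip: neg pos)
qed

end
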